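(* There exists a neighborhood $W\subset\mathbb{R}^2$ of the parameter $(a,b)=(1,\tfrac12)$ such that $h_{top}(\mathcal{L}_{a,b})=0$ for all $(a,b)\in W$.
   Context: For $a,b\in\mathbb{R}$, $b\neq 0$, the Lozi map is the homeomorphism $\mathcal{L}_{a,b}:\mathbb{R}^2\to\mathbb{R}^2$, $\mathcal{L}_{a,b}(x,y)=(1-a|x|+by,\;x)$. Since $\mathbb{R}^2$ is not compact, $h_{top}(\mathcal{L}_{a,b})$ is understood as the supremum of the (usual) topological entropies of the restrictions $\mathcal{L}_{a,b}|_C$ over all compact sets $C\subset\mathbb{R}^2$ with $\mathcal{L}_{a,b}(C)=C$ (and $0$ if there is no nonempty such $C$). *)

theory Defs
  imports "HOL-Analysis.Analysis"
begin

definition lozi :: "real \<Rightarrow> real \<Rightarrow> real \<times> real \<Rightarrow> real \<times> real" where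
  "lozi a b = (\<lambda>(x, y). (1 - a * \<bar>x\<bar> + b * y, x))"

text \<open>Topological entropy is rendered in the Bowen--Dinaburg form. A set \<open>E\<close> is
  \<open>(n, \<epsilon>)\<close>-separated if any two distinct points of \<open>E\<close> are more than \<open>\<epsilon>\<close> apart in the
  metric \<open>d\<^sub>n(x, y) = max {d(f\<^sup>k x, f\<^sup>k y) | 0 \<le> k < n}\<close>.\<close>

definition separated_orbits :: "('a::metric_space \<Rightarrow> 'a) \<Rightarrow> nat \<Rightarrow> real \<Rightarrow> 'a set \<Rightarrow> bool" where
  "separated_orbits f n \<epsilon> E \<longleftrightarrow>
     (\<forall>x\<in>E. \<forall>y\<in>E. x \<noteq> y \<longrightarrow> (\<exists>k<n. dist ((f ^^ k) x) ((f ^^ k) y) > \<epsilon>))"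

text \<open>The logarithm of the largest cardinality of an \<open>(n, \<epsilon>)\<close>-separated subset of \<open>C\<close>. The
  supremum is taken in \<open>ereal\<close>, so that it is meaningful without any finiteness proof; the empty
  set \<open>E\<close> contributes \<open>ln 0 = 0\<close>, as a singleton does.\<close>

definition log_max_separated ::
    "('a::metric_space \<Rightarrow> 'a) \<Rightarrow> 'a set \<Rightarrow> nat \<Rightarrow> real \<Rightarrow> ereal" where
  "log_max_separated f C n \<epsilon> =
     (SUP E\<in>{E. E \<subseteq> C \<and> finite E \<and> separated_orbits f n \<epsilon> E}. ereal (ln (real (card E))))"

text \<open>For compact \<open>C\<close> with \<open>f ` C \<subseteq> C\<close> and \<open>f\<close> continuous on \<open>C\<close> this is the topological entropy
  of the restriction of \<open>f\<close> to \<open>C\<close>. The growth rate increases as \<open>\<epsilon>\<close> decreases, so the supremum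
  over \<open>\<epsilon>\<close> is the usual limit as \<open>\<epsilon>\<close> tends to \<open>0\<close> (\<open>tendsto_topological_entropy_on\<close> below).\<close>

definition separated_growth :: "('a::metric_space \<Rightarrow> 'a) \<Rightarrow> 'a set \<Rightarrow> real \<Rightarrow> ereal" where
  "separated_growth f C \<epsilon> = limsup (\<lambda>n. log_max_separated f C n \<epsilon> / ereal (real n))"

definition topological_entropy_on :: "('a::metric_space \<Rightarrow> 'a) \<Rightarrow> 'a set \<Rightarrow> ereal" where
  "topological_entropy_on f C = (SUP \<epsilon>\<in>{0<..}. separated_growth f C \<epsilon>)"

text \<open>Entropy of a map of a possibly non-compact space. The set \<open>C = {}\<close> always
  qualifies and contributes \<open>0\<close>, so the value is \<open>0\<close> if there is no other such \<open>C\<close>.\<close>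

definition topological_entropy :: "('a::metric_space \<Rightarrow> 'a) \<Rightarrow> ereal" where
  "topological_entropy f = (SUP C\<in>{C. compact C \<and> f ` C = C}. topological_entropy_on f C)"

lemma log_max_separated_nonneg: "log_max_separated f C n \<epsilon> \<ge> 0"
  unfolding log_max_separated_def
  by (rule SUP_upper2[where i = "{}"]) (auto simp: separated_orbits_def)

lemma separated_orbits_antimono:
  assumes sep: "separated_orbits f n \<delta> E" and le: "\<epsilon> \<le> \<delta>"
  shows "separated_orbits f n \<epsilon> E"
  unfolding separated_orbits_def
proof (intro ballI impI)
  fix x y assume "x \<in> E" "y \<in> E" "x \<noteq> y"
  with sep obtain k where k: "k < n" "dist ((f ^^ k) x) ((f ^^ k) y) > \<delta>"
    unfolding separated_orbits_def by blast
  from le k(2) have "dist ((f ^^ k) x) ((f ^^ k) y) > \<epsilon>"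
    by (rule order.strict_trans1)
  with k(1) show "\<exists>k<n. dist ((f ^^ k) x) ((f ^^ k) y) > \<epsilon>"
    by blast
qed

lemma log_max_separated_antimono:
  assumes "\<epsilon> \<le> \<delta>"
  shows "log_max_separated f C n \<delta> \<le> log_max_separated f C n \<epsilon>"
  unfolding log_max_separated_def
proof (rule SUP_subset_mono)
  show "{E. E \<subseteq> C \<and> finite E \<and> separated_orbits f n \<delta> E}
      \<subseteq> {E. E \<subseteq> C \<and> finite E \<and> separated_orbits f n \<epsilon> E}"
    using separated_orbits_antimono[OF _ assms] by blast
qed (rule order_refl)

lemma separated_growth_antimono:
  assumes "\<epsilon> \<le> \<delta>"
  shows "separated_growth f C \<delta> \<le> separated_growth f C \<epsilon>"
  unfolding separated_growth_def
proof (rule Limsup_mono, rule eventually_sequentiallyI[of 1])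
  fix n :: nat assume "1 \<le> n"
  then show "log_max_separated f C n \<delta> / ereal (real n) \<le> log_max_separated f C n \<epsilon> / ereal (real n)"
    using log_max_separated_antimono[OF assms] by (intro ereal_divide_right_mono) auto
qed

lemma tendsto_topological_entropy_on:
  "(separated_growth f C \<longlongrightarrow> topological_entropy_on f C) (at_right 0)"
proof (rule order_tendstoI)
  fix a assume "a < topological_entropy_on f C"
  then obtain \<delta> where \<delta>: "\<delta> > 0" "a < separated_growth f C \<delta>"
    unfolding topological_entropy_on_def by (auto simp: less_SUP_iff)
  have "a < separated_growth f C \<epsilon>" if "\<epsilon> < \<delta>" for \<epsilon>
    using \<delta>(2) separated_growth_antimono[of \<epsilon> \<delta> f C] that by simp
  then show "\<forall>\<^sub>F \<epsilon> in at_right 0. a < separated_growth f C \<epsilon>"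
    unfolding eventually_at_right_field using \<delta>(1) by blast
next
  fix a assume a: "topological_entropy_on f C < a"
  have "separated_growth f C \<epsilon> < a" if "\<epsilon> > 0" for \<epsilon>
  proof -
    have "separated_growth f C \<epsilon> \<le> topological_entropy_on f C"
      unfolding topological_entropy_on_def using that by (intro SUP_upper) simp
    then show ?thesis using a by simp
  qed
  then show "\<forall>\<^sub>F \<epsilon> in at_right 0. separated_growth f C \<epsilon> < a"
    unfolding eventually_at_right_field by (intro exI[of _ 1]) simp
qed

lemma topological_entropy_on_empty: "topological_entropy_on f {} = 0"
proof -
  have "log_max_separated f {} n \<epsilon> \<le> 0" for n \<epsilon>
    unfolding log_max_separated_def by (rule SUP_least) auto
  then have "log_max_separated f {} n \<epsilon> = 0" for n \<epsilon>
    using log_max_separated_nonneg by (rule antisym)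
  then have "separated_growth f {} \<epsilon> = 0" for \<epsilon>
    unfolding separated_growth_def by (simp add: Limsup_const)
  then show ?thesis
    unfolding topological_entropy_on_def by simp
qed

end

theory Submission imports Defs begin

text \<open>The first coordinates of an orbit satisfy \<open>x\<^sub>n\<^sub>+\<^sub>2 = 1 - a \<bar>x\<^sub>n\<^sub>+\<^sub>1\<bar> + b x\<^sub>n\<close>. For parameters near
  (1, 1/2), a bounded full orbit lies in a fixed strip, and linear inequalities show that once its
  sign changes from \<open>+\<close> to \<open>-\<close>, it alternates forever; so its itinerary has the form
  \<open>-\<^sup>i +\<^sup>l (- +)\<^sup>\<infinity>\<close>, and there are at most \<open>(n + 1)\<^sup>2\<close> itineraries of length \<open>n\<close>. On points sharing
  an itinerary the first \<open>n\<close> iterates are affine with common linear parts, so that the metric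
  \<open>d\<^sub>n\<close> is induced by a seminorm of the plane; a separated set of bounded diameter for such a
  metric has a size bounded independently of \<open>n\<close>. Separated sets thus grow at most quadratically.\<close>

subsection \<open>Separated sets under linear maps of the plane\<close>

lemma finite_attains_max:
  fixes f :: "'a \<Rightarrow> 'b::linorder"
  assumes "finite A" "A \<noteq> {}"
  obtains x where "x \<in> A" "\<And>y. y \<in> A \<Longrightarrow> f y \<le> f x"
proof -
  have "Max (f ` A) \<in> f ` A" using assms by simp
  then obtain x where x: "x \<in> A" "f x = Max (f ` A)" by auto
  show ?thesis by (rule that[OF x(1)]) (simp add: x(2) assms(1))
qed

text \<open>The corners are those of a triangle of maximal area, by Cramer's rule.\<close>

lemma finite_plane_parallelogram:
  fixes F :: "(real \<times> real) set"
  assumes fin: "finite F" and ne: "F \<noteq> {}"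
  obtains p q r where "p \<in> F" "q \<in> F" "r \<in> F"
    "\<And>s. s \<in> F \<Longrightarrow> \<exists>\<alpha> \<beta>. \<bar>\<alpha>\<bar> \<le> 1 \<and> \<bar>\<beta>\<bar> \<le> 1 \<and> s - p = \<alpha> *\<^sub>R (q - p) + \<beta> *\<^sub>R (r - p)"
proof -
  define det :: "real \<times> real \<Rightarrow> real \<times> real \<Rightarrow> real"
    where "det u v = fst u * snd v - snd u * fst v" for u v
  define area where "area = (\<lambda>(p, q, r). \<bar>det (q - p) (r - p)\<bar>)"
  have "finite (F \<times> F \<times> F)" "F \<times> F \<times> F \<noteq> {}"
    using fin ne by auto
  then obtain t where t: "t \<in> F \<times> F \<times> F" "\<And>t'. t' \<in> F \<times> F \<times> F \<Longrightarrow> area t' \<le> area t"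
    using finite_attains_max[of "F \<times> F \<times> F" area] by blast
  obtain p q r where tpqr: "t = (p, q, r)" by (cases t) auto
  have pqr: "p \<in> F" "q \<in> F" "r \<in> F" using t(1) tpqr by auto
  have max: "\<bar>det (v - u) (w - u)\<bar> \<le> \<bar>det (q - p) (r - p)\<bar>" if "u \<in> F" "v \<in> F" "w \<in> F" for u v w
    using t(2)[of "(u, v, w)"] that tpqr by (simp add: area_def)
  show ?thesis
  proof (cases "det (q - p) (r - p) = 0")
    case False
    let ?d = "det (q - p) (r - p)"
    show ?thesis
    proof (rule that[OF pqr])
      fix s assume s: "s \<in> F"
      let ?\<alpha> = "det (s - p) (r - p) / ?d" and ?\<beta> = "det (q - p) (s - p) / ?d"
      have "\<bar>?\<alpha>\<bar> \<le> 1" "\<bar>?\<beta>\<bar> \<le> 1"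
        using max[OF pqr(1) s pqr(3)] max[OF pqr(1,2) s] False by (simp_all add: divide_le_eq)
      moreover have "?d *\<^sub>R (s - p) = det (s - p) (r - p) *\<^sub>R (q - p) + det (q - p) (s - p) *\<^sub>R (r - p)"
        by (rule prod_eqI) (simp_all add: det_def algebra_simps)
      then have "s - p = (1 / ?d) *\<^sub>R (det (s - p) (r - p) *\<^sub>R (q - p) + det (q - p) (s - p) *\<^sub>R (r - p))"
        using False by (metis divide_self scaleR_one scaleR_scaleR times_divide_eq_left mult_1)
      then have "s - p = ?\<alpha> *\<^sub>R (q - p) + ?\<beta> *\<^sub>R (r - p)"
        by (simp add: scaleR_add_right)
      ultimately show "\<exists>\<alpha> \<beta>. \<bar>\<alpha>\<bar> \<le> 1 \<and> \<bar>\<beta>\<bar> \<le> 1 \<and> s - p = \<alpha> *\<^sub>R (q - p) + \<beta> *\<^sub>R (r - p)"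
        by blast
    qed
  next
    \<comment> \<open>The largest triangle has area 0, so \<open>F\<close> lies on a line. A point
      \<open>q'\<close> farthest from \<open>p'\<close> then reaches every other point with a
      coefficient of modulus at most 1, and the second direction is taken to be 0.\<close>
    case True
    obtain p' where p': "p' \<in> F" using ne by blast
    obtain q' where q': "q' \<in> F" "\<And>s. s \<in> F \<Longrightarrow> norm (s - p') \<le> norm (q' - p')"
      using finite_attains_max[OF fin ne, of "\<lambda>s. norm (s - p')"] by blast
    show ?thesis
    proof (rule that[OF p' q'(1) p'])
      fix s assume s: "s \<in> F"
      have d0: "det (q' - p') (s - p') = 0"
        using max[OF p' q'(1) s] True by simp
      have "\<exists>\<alpha>. \<bar>\<alpha>\<bar> \<le> 1 \<and> s - p' = \<alpha> *\<^sub>R (q' - p')"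
      proof (cases "q' = p'")
        case True
        then show ?thesis using q'(2)[OF s] by (intro exI[of _ 0]) simp
      next
        case False
        define u v where "u = q' - p'" and "v = s - p'"
        have u0: "u \<noteq> 0" using False by (simp add: u_def)
        have d: "fst u * snd v = snd u * fst v" using d0 by (simp add: det_def u_def v_def)
        have "(u \<bullet> u) *\<^sub>R v = (u \<bullet> v) *\<^sub>R u"
        proof (rule prod_eqI)
          show "fst ((u \<bullet> u) *\<^sub>R v) = fst ((u \<bullet> v) *\<^sub>R u)"
            using d by (simp add: inner_prod_def algebra_simps)
          show "snd ((u \<bullet> u) *\<^sub>R v) = snd ((u \<bullet> v) *\<^sub>R u)"
            using d by (simp add: inner_prod_def algebra_simps)
        qed
        moreover have "v = (1 / (u \<bullet> u)) *\<^sub>R ((u \<bullet> u) *\<^sub>R v)" using u0 by simp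
        ultimately have v: "v = ((u \<bullet> v) / (u \<bullet> u)) *\<^sub>R u" by simp
        have "\<bar>(u \<bullet> v) / (u \<bullet> u)\<bar> * norm u = norm v"
          using arg_cong[OF v, of norm] unfolding norm_scaleR by (rule sym)
        also have "\<dots> \<le> 1 * norm u" using q'(2)[OF s] by (simp add: u_def v_def)
        finally have "\<bar>(u \<bullet> v) / (u \<bullet> u)\<bar> \<le> 1"
          by (rule mult_right_le_imp_le) (simp add: u0)
        with v show ?thesis unfolding u_def v_def by blast
      qed
      then obtain \<alpha> where "\<bar>\<alpha>\<bar> \<le> 1" "s - p' = \<alpha> *\<^sub>R (q' - p')" by blast
      then show "\<exists>\<alpha> \<beta>. \<bar>\<alpha>\<bar> \<le> 1 \<and> \<bar>\<beta>\<bar> \<le> 1 \<and> s - p' = \<alpha> *\<^sub>R (q' - p') + \<beta> *\<^sub>R (p' - p')"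
        by (intro exI[of _ \<alpha>] exI[of _ 0]) simp
    qed
  qed
qed

text \<open>In the parallelogram coordinates every point lies in the square [-1, 1] x [-1, 1], which
  is cut into cells of side \<open>1 / m\<close>. Two points of one cell are at most
  \<open>2 * D / m\<close>, hence at most \<open>\<epsilon>\<close>, apart under every
  \<open>T k\<close>, so each cell holds at most one point. This count does not depend on how many
  maps there are.\<close>

lemma card_linear_separated_le:
  fixes F :: "(real \<times> real) set" and T :: "'i \<Rightarrow> real \<times> real \<Rightarrow> 'b::real_normed_vector"
  assumes fin: "finite F"
    and lin: "\<And>k. k \<in> I \<Longrightarrow> linear (T k)"
    and bdd: "\<And>p q k. p \<in> F \<Longrightarrow> q \<in> F \<Longrightarrow> k \<in> I \<Longrightarrow> norm (T k (p - q)) \<le> D"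
    and sep: "\<And>p q. p \<in> F \<Longrightarrow> q \<in> F \<Longrightarrow> p \<noteq> q \<Longrightarrow> \<exists>k\<in>I. norm (T k (p - q)) > \<epsilon>"
    and m: "m > 0" "2 * D \<le> \<epsilon> * real m"
  shows "card F \<le> (2 * m + 1)\<^sup>2"
proof (cases "F = {}")
  case False
  from finite_plane_parallelogram[OF fin False] obtain p q r where
    pqr: "p \<in> F" "q \<in> F" "r \<in> F" and
    ex: "\<And>s. s \<in> F \<Longrightarrow> \<exists>\<alpha> \<beta>. \<bar>\<alpha>\<bar> \<le> 1 \<and> \<bar>\<beta>\<bar> \<le> 1 \<and> s - p = \<alpha> *\<^sub>R (q - p) + \<beta> *\<^sub>R (r - p)"
    by metis
  from ex obtain \<alpha> \<beta> where ab: "\<And>s. s \<in> F \<Longrightarrow> \<bar>\<alpha> s\<bar> \<le> 1" "\<And>s. s \<in> F \<Longrightarrow> \<bar>\<beta> s\<bar> \<le> 1"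
    "\<And>s. s \<in> F \<Longrightarrow> s - p = \<alpha> s *\<^sub>R (q - p) + \<beta> s *\<^sub>R (r - p)"
    by metis
  define cell where "cell s = (\<lfloor>\<alpha> s * real m\<rfloor>, \<lfloor>\<beta> s * real m\<rfloor>)" for s
  have near: "\<bar>x - y\<bar> \<le> 1 / real m" if "\<lfloor>x * real m\<rfloor> = \<lfloor>y * real m\<rfloor>" for x y
  proof -
    have "\<bar>x * real m - y * real m\<bar> \<le> 1" using that by linarith
    then have "\<bar>x - y\<bar> * real m \<le> 1" by (simp add: abs_mult flip: left_diff_distrib)
    then show ?thesis using m(1) by (simp add: field_simps)
  qed
  have "inj_on cell F"
  proof (rule inj_onI, rule ccontr)
    fix s t assume st: "s \<in> F" "t \<in> F" "cell s = cell t" "s \<noteq> t"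
    from sep[OF st(1,2,4)] obtain k where k: "k \<in> I" "norm (T k (s - t)) > \<epsilon>" by blast
    have "s - t = (s - p) - (t - p)" by simp
    also have "\<dots> = (\<alpha> s - \<alpha> t) *\<^sub>R (q - p) + (\<beta> s - \<beta> t) *\<^sub>R (r - p)"
      unfolding ab(3)[OF st(1)] ab(3)[OF st(2)] by (simp add: algebra_simps)
    finally have "s - t = (\<alpha> s - \<alpha> t) *\<^sub>R (q - p) + (\<beta> s - \<beta> t) *\<^sub>R (r - p)" .
    then have "T k (s - t) = (\<alpha> s - \<alpha> t) *\<^sub>R T k (q - p) + (\<beta> s - \<beta> t) *\<^sub>R T k (r - p)"
      using lin[OF k(1)] by (simp add: linear_add linear_scale)
    then have "norm (T k (s - t)) \<le> \<bar>\<alpha> s - \<alpha> t\<bar> * norm (T k (q - p)) + \<bar>\<beta> s - \<beta> t\<bar> * norm (T k (r - p))"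
      by (metis norm_triangle_ineq norm_scaleR)
    also have "\<dots> \<le> 1 / real m * D + 1 / real m * D"
      using st(3) pqr k(1) by (intro add_mono mult_mono near bdd) (auto simp: cell_def)
    also have "\<dots> \<le> \<epsilon>" using m by (simp add: field_simps)
    finally show False using k(2) by simp
  qed
  moreover have "cell ` F \<subseteq> {- int m..int m} \<times> {- int m..int m}"
  proof -
    \<comment> \<open>The floor \<open>m\<close> is attained at \<open>x = 1\<close>, so each
      coordinate has \<open>2 * m + 1\<close> classes rather than \<open>2 * m\<close>.\<close>
    have "\<lfloor>x * real m\<rfloor> \<in> {- int m..int m}" if "\<bar>x\<bar> \<le> 1" for x
    proof -
      have "\<bar>x * real m\<bar> \<le> real m" using mult_right_mono[OF that, of "real m"] by (simp add: abs_mult)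
      then show ?thesis by (auto simp: abs_le_iff le_floor_iff floor_le_iff)
    qed
    then show ?thesis using ab(1,2) by (auto simp: cell_def)
  qed
  ultimately have "card F \<le> card ({- int m..int m} \<times> {- int m..int m})"
    by (intro card_inj_on_le) auto
  also have "\<dots> = (2 * m + 1)\<^sup>2"
    by (simp add: card_cartesian_product power2_eq_square nat_add_distrib nat_mult_distrib)
  finally show ?thesis .
qed simp

subsection \<open>Itineraries\<close>

text \<open>Here \<open>i\<close> is the first index where \<open>P\<close> holds and
  \<open>j\<close> the first later one where it fails; from then on the change repeats every two
  steps. A value \<open>n\<close> of either index means that the event does not occur before
  \<open>n\<close>. Thus two numbers up to \<open>n\<close> encode the whole word.\<close>

lemma eventually_alternating_word:
  fixes P :: "nat \<Rightarrow> bool"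
  assumes alt: "\<And>k. P k \<Longrightarrow> \<not> P (Suc k) \<Longrightarrow> P (k + 2) \<and> \<not> P (k + 3)"
  shows "\<exists>i\<le>n. \<exists>j\<le>n. \<forall>k<n. P k \<longleftrightarrow> i \<le> k \<and> (k < j \<or> odd (k - j))"
proof (cases "\<exists>k<n. P k")
  case False
  then show ?thesis by (intro exI[of _ n] conjI order_refl) auto
next
  case True
  define i where "i = (LEAST k. P k)"
  have i: "P i" "i < n" "\<And>k. k < i \<Longrightarrow> \<not> P k"
    using True LeastI_ex[of P] Least_le[of P] not_less_Least[of _ P] unfolding i_def
    by (blast, meson le_less_trans, blast)
  show ?thesis
  proof (cases "\<exists>k<n. i \<le> k \<and> \<not> P k")
    case False
    then show ?thesis using i by (intro exI[of _ i] conjI exI[of _ n]) (auto, meson not_le)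
  next
    case True
    define j where "j = (LEAST k. i \<le> k \<and> \<not> P k)"
    have j: "i \<le> j" "\<not> P j" "j < n" "\<And>k. i \<le> k \<Longrightarrow> k < j \<Longrightarrow> P k"
      using True LeastI_ex[of "\<lambda>k. i \<le> k \<and> \<not> P k"] Least_le[of "\<lambda>k. i \<le> k \<and> \<not> P k"]
        not_less_Least[of _ "\<lambda>k. i \<le> k \<and> \<not> P k"] unfolding j_def
      by (blast, blast, meson le_less_trans, blast)
    have "i < j" using i(1) j(1,2) by (metis le_neq_implies_less)
    then obtain h where h: "j = Suc h" "P h" using j(4) by (cases j) auto
    have step: "P (h + 2 * l) \<and> \<not> P (Suc h + 2 * l)" for l
    proof (induction l)
      case (Suc l)
      then show ?case using alt[of "h + 2 * l"] by (simp add: numeral_3_eq_3)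
    qed (use h j(2) in auto)
    have tail: "P k \<longleftrightarrow> odd (k - j)" if "j \<le> k" for k
    proof -
      obtain l where "k - j = 2 * l \<or> k - j = 2 * l + 1" by (metis oddE evenE)
      then have "k - j = 2 * l \<and> k = Suc h + 2 * l \<or> k - j = 2 * l + 1 \<and> k = h + 2 * Suc l"
        using that h(1) by auto
      then show ?thesis using step[of l] step[of "Suc l"] by (elim disjE conjE) auto
    qed
    have "P k \<longleftrightarrow> i \<le> k \<and> (k < j \<or> odd (k - j))" for k
      using tail[of k] i(3)[of k] j(4)[of k] j(1) by (meson le_trans not_le)
    then show ?thesis using i(2) j(3) by (meson less_imp_le)
  qed
qed

subsection \<open>Entropy of Lozi maps with eventually alternating itineraries\<close>

text \<open>The map is affine on each of the half-planes \<open>x \<ge> 0\<close> and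
  \<open>x < 0\<close>, and for each \<open>k < n\<close> the \<open>k\<close>-th image of
  \<open>F\<close> stays in one of them. Differences of points remove the translation part.\<close>

lemma lozi_funpow_linear_on:
  assumes same: "\<And>p q k. p \<in> F \<Longrightarrow> q \<in> F \<Longrightarrow> k < n \<Longrightarrow>
      0 \<le> fst ((lozi a b ^^ k) p) \<longleftrightarrow> 0 \<le> fst ((lozi a b ^^ k) q)"
    and "k \<le> n"
  shows "\<exists>T. linear T \<and> (\<forall>p\<in>F. \<forall>q\<in>F. (lozi a b ^^ k) p - (lozi a b ^^ k) q = T (p - q))"
  using \<open>k \<le> n\<close>
proof (induction k)
  case 0
  show ?case by (intro exI[of _ "\<lambda>v. v"]) (simp add: linear_ident)
next
  case (Suc k)
  then obtain T where T: "linear T"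
    "\<And>p q. p \<in> F \<Longrightarrow> q \<in> F \<Longrightarrow> (lozi a b ^^ k) p - (lozi a b ^^ k) q = T (p - q)"
    by auto
  \<comment> \<open>The common sign of the first coordinate on the \<open>k\<close>-th image of
    \<open>F\<close>; \<open>S\<close> below is the linear part of the branch with this
    sign.\<close>
  define \<sigma> :: real where "\<sigma> = (if \<exists>p\<in>F. 0 \<le> fst ((lozi a b ^^ k) p) then 1 else - 1)"
  have abs: "\<bar>fst ((lozi a b ^^ k) p)\<bar> = \<sigma> * fst ((lozi a b ^^ k) p)" if "p \<in> F" for p
  proof (cases "0 \<le> fst ((lozi a b ^^ k) p)")
    case True
    then have "\<sigma> = 1" using that by (auto simp: \<sigma>_def)
    then show ?thesis using True by simp
  next
    case False
    then have "\<sigma> = - 1" using same[OF that, of _ k] Suc.prems by (auto simp: \<sigma>_def)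
    then show ?thesis using False by simp
  qed
  define S :: "real \<times> real \<Rightarrow> real \<times> real" where "S v = (b * snd v - a * \<sigma> * fst v, fst v)" for v
  have "linear S" by (auto intro!: linearI simp: S_def algebra_simps)
  moreover have "(lozi a b ^^ Suc k) p - (lozi a b ^^ Suc k) q = S ((lozi a b ^^ k) p - (lozi a b ^^ k) q)"
    if "p \<in> F" "q \<in> F" for p q
    using abs[OF that(1)] abs[OF that(2)] by (simp add: lozi_def S_def case_prod_beta algebra_simps)
  ultimately show ?case
    using T by (intro exI[of _ "S \<circ> T"] conjI linear_compose) simp_all
qed

lemma card_separated_orbits_lozi_le:
  assumes alt: "\<And>p. p \<in> C \<Longrightarrow> 0 \<le> fst p \<Longrightarrow> fst (lozi a b p) < 0 \<Longrightarrow>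
      0 \<le> fst ((lozi a b ^^ 2) p) \<and> fst ((lozi a b ^^ 3) p) < 0"
    and inv: "lozi a b ` C \<subseteq> C"
    and D: "\<And>p q. p \<in> C \<Longrightarrow> q \<in> C \<Longrightarrow> dist p q \<le> D"
    and m: "m > 0" "2 * D \<le> \<epsilon> * real m"
    and E: "E \<subseteq> C" "finite E" "separated_orbits (lozi a b) n \<epsilon> E"
  shows "card E \<le> (n + 1)\<^sup>2 * (2 * m + 1)\<^sup>2"
proof -
  let ?f = "lozi a b"
  have invk: "(?f ^^ k) p \<in> C" if "p \<in> C" for p k
    using that inv by (induction k) auto
  have "\<exists>c\<in>{..n} \<times> {..n}. \<forall>k<n. 0 \<le> fst ((?f ^^ k) p) \<longleftrightarrow> fst c \<le> k \<and> (k < snd c \<or> odd (k - snd c))"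
    if "p \<in> E" for p
  proof -
    have "0 \<le> fst ((?f ^^ (k + 2)) p) \<and> \<not> 0 \<le> fst ((?f ^^ (k + 3)) p)"
      if "0 \<le> fst ((?f ^^ k) p)" "\<not> 0 \<le> fst ((?f ^^ Suc k) p)" for k
      using alt[of "(?f ^^ k) p"] invk[of p k] \<open>p \<in> E\<close> E(1) that
      by (auto simp: numeral_2_eq_2 numeral_3_eq_3 not_le)
    from eventually_alternating_word[of "\<lambda>k. 0 \<le> fst ((?f ^^ k) p)", OF this]
    obtain i j where "i \<le> n" "j \<le> n"
      "\<forall>k<n. 0 \<le> fst ((?f ^^ k) p) \<longleftrightarrow> i \<le> k \<and> (k < j \<or> odd (k - j))"
      by blast
    then show ?thesis by (intro bexI[of _ "(i, j)"]) simp_all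
  qed
  then obtain code where code: "\<And>p. p \<in> E \<Longrightarrow> code p \<in> {..n} \<times> {..n}"
    "\<And>p k. p \<in> E \<Longrightarrow> k < n \<Longrightarrow> 0 \<le> fst ((?f ^^ k) p) \<longleftrightarrow>
      fst (code p) \<le> k \<and> (k < snd (code p) \<or> odd (k - snd (code p)))"
    by metis
  \<comment> \<open>All iterates stay in \<open>C\<close>, so the diameter bound \<open>D\<close>
    also bounds \<open>T k (p - q)\<close> for every \<open>k\<close>. This makes the size of a
    fibre independent of \<open>n\<close>.\<close>
  have fibre: "card {p\<in>E. code p = c} \<le> (2 * m + 1)\<^sup>2" for c
  proof -
    let ?F = "{p\<in>E. code p = c}"
    have "\<forall>k\<in>{..n}. \<exists>T. linear T \<and> (\<forall>p\<in>?F. \<forall>q\<in>?F. (?f ^^ k) p - (?f ^^ k) q = T (p - q))"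
      by (intro ballI lozi_funpow_linear_on[where n = n]) (use code(2) in auto)
    from bchoice[OF this] obtain T where "\<forall>k\<in>{..n}. linear (T k) \<and>
        (\<forall>p\<in>?F. \<forall>q\<in>?F. (?f ^^ k) p - (?f ^^ k) q = T k (p - q))"
      by blast
    then have T: "\<And>k. k \<le> n \<Longrightarrow> linear (T k)"
      "\<And>k p q. k \<le> n \<Longrightarrow> p \<in> ?F \<Longrightarrow> q \<in> ?F \<Longrightarrow> (?f ^^ k) p - (?f ^^ k) q = T k (p - q)"
      by auto
    show ?thesis
    proof (rule card_linear_separated_le[where I = "{..<n}" and T = T and D = D and \<epsilon> = \<epsilon>])
      show "norm (T k (p - q)) \<le> D" if "p \<in> ?F" "q \<in> ?F" "k \<in> {..<n}" for p q k
      proof -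
        have "p \<in> C" "q \<in> C" using that(1,2) E(1) by auto
        then show ?thesis using that T(2)[of k p q] D[OF invk invk, of p q k k] by (simp add: dist_norm)
      qed
      show "\<exists>k\<in>{..<n}. \<epsilon> < norm (T k (p - q))" if pq: "p \<in> ?F" "q \<in> ?F" "p \<noteq> q" for p q
      proof -
        obtain k where "k < n" "\<epsilon> < dist ((?f ^^ k) p) ((?f ^^ k) q)"
          using E(3)[unfolded separated_orbits_def, rule_format, of p q] pq by auto
        then show ?thesis using T(2)[of k p q] pq by (auto simp: dist_norm)
      qed
    qed (use E(2) T(1) m in auto)
  qed
  have "card E \<le> card (\<Union>c\<in>{..n} \<times> {..n}. {p\<in>E. code p = c})"
    by (rule card_mono) (use E(2) code(1) in auto)
  also have "\<dots> \<le> (\<Sum>c\<in>{..n} \<times> {..n}. card {p\<in>E. code p = c})"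
    by (rule card_UN_le) simp
  also have "\<dots> \<le> card ({..n} \<times> {..n}) * (2 * m + 1)\<^sup>2"
    using sum_bounded_above[of "{..n} \<times> {..n}", OF fibre] by (simp only: of_nat_id)
  finally show ?thesis by (simp add: card_cartesian_product power2_eq_square)
qed

lemma topological_entropy_on_lozi_le_0:
  assumes C: "compact C" and inv: "lozi a b ` C \<subseteq> C"
    and alt: "\<And>p. p \<in> C \<Longrightarrow> 0 \<le> fst p \<Longrightarrow> fst (lozi a b p) < 0 \<Longrightarrow>
      0 \<le> fst ((lozi a b ^^ 2) p) \<and> fst ((lozi a b ^^ 3) p) < 0"
  shows "topological_entropy_on (lozi a b) C \<le> 0"
  unfolding topological_entropy_on_def
proof (rule SUP_least)
  fix \<epsilon> :: real assume "\<epsilon> \<in> {0<..}"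
  then have \<epsilon>: "\<epsilon> > 0" by simp
  obtain D where D: "\<And>p q. p \<in> C \<Longrightarrow> q \<in> C \<Longrightarrow> dist p q \<le> D"
    using compact_imp_bounded[OF C] unfolding bounded_two_points by blast
  obtain m' :: nat where "2 * D / \<epsilon> \<le> real m'" using real_arch_simple by blast
  then have m: "Suc m' > 0" "2 * D \<le> \<epsilon> * real (Suc m')"
    using \<epsilon> by (simp_all add: field_simps)
  \<comment> \<open>The factor 4 comes from \<open>(n + 1)\<^sup>2 \<le> (2 * n)\<^sup>2\<close> for
    \<open>n \<ge> 1\<close>.\<close>
  define M where "M = 4 * real ((2 * Suc m' + 1)\<^sup>2)"
  have "1 \<le> real ((2 * Suc m' + 1)\<^sup>2)"
    unfolding of_nat_power by (rule one_le_power) simp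
  then have M: "M \<ge> 1" unfolding M_def by linarith
  have bound: "log_max_separated (lozi a b) C n \<epsilon> \<le> ereal (2 * ln (real n) + ln M)" if n: "n \<ge> 1" for n
    unfolding log_max_separated_def
  proof (rule SUP_least)
    fix E assume "E \<in> {E. E \<subseteq> C \<and> finite E \<and> separated_orbits (lozi a b) n \<epsilon> E}"
    then have "card E \<le> (n + 1)\<^sup>2 * (2 * Suc m' + 1)\<^sup>2"
      using card_separated_orbits_lozi_le[OF alt inv D m] by blast
    also have "\<dots> \<le> (2 * n)\<^sup>2 * (2 * Suc m' + 1)\<^sup>2"
      using n by (intro mult_right_mono power_mono) auto
    finally have "real (card E) \<le> real ((2 * n)\<^sup>2 * (2 * Suc m' + 1)\<^sup>2)"
      by (simp only: of_nat_le_iff)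
    then have card: "real (card E) \<le> (real n)\<^sup>2 * M"
      unfolding M_def by (simp add: power_mult_distrib)
    have ln: "ln ((real n)\<^sup>2 * M) = 2 * ln (real n) + ln M"
      using M n by (simp add: ln_mult ln_realpow)
    have "ln (real (card E)) \<le> 2 * ln (real n) + ln M"
    \<comment> \<open>Monotonicity of \<open>ln\<close> needs a positive argument; for empty
      \<open>E\<close> the value is \<open>ln 0 = 0\<close>.\<close>
    proof (cases "card E = 0")
      case True
      have "0 \<le> 2 * ln (real n)" "0 \<le> ln M" using M n by simp_all
      then show ?thesis using True by simp
    next
      case False
      then have "ln (real (card E)) \<le> ln ((real n)\<^sup>2 * M)"
        using card M n by (subst ln_le_cancel_iff) auto
      then show ?thesis using ln by simp
    qed
    then show "ereal (ln (real (card E))) \<le> ereal (2 * ln (real n) + ln M)" by simp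
  qed
  define g where "g n = 2 * (ln (real n) / real n) + ln M / real n" for n
  have "log_max_separated (lozi a b) C n \<epsilon> / ereal (real n) \<le> ereal (g n)" if n: "n \<ge> 1" for n
  proof -
    have "log_max_separated (lozi a b) C n \<epsilon> / ereal (real n) \<le> ereal (2 * ln (real n) + ln M) / ereal (real n)"
      using bound[OF n] n by (intro ereal_divide_right_mono) auto
    also have "\<dots> = ereal (g n)" using n by (simp add: g_def add_divide_distrib)
    finally show ?thesis .
  qed
  then have "separated_growth (lozi a b) C \<epsilon> \<le> limsup (\<lambda>n. ereal (g n))"
    unfolding separated_growth_def by (intro Limsup_mono eventually_sequentiallyI[of 1])
  moreover have "g \<longlonglongrightarrow> 2 * 0 + 0"
    unfolding g_def by (intro tendsto_intros lim_ln_over_n lim_const_over_n)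
  then have "limsup (\<lambda>n. ereal (g n)) = ereal 0"
    by (intro lim_imp_Limsup) simp_all
  ultimately show "separated_growth (lozi a b) C \<epsilon> \<le> 0" by (simp add: zero_ereal_def)
qed

subsection \<open>Itineraries near the parameter (1, 1/2)\<close>

lemma lozi_bounds:
  assumes near: "\<bar>a - 1\<bar> < 1 / 1000" "\<bar>b - 1 / 2\<bar> < 1 / 1000"
    and C: "compact C" "lozi a b ` C = C" and p: "p \<in> C"
  shows "fst p \<le> 202 / 100" "- (41 / 10) \<le> fst p"
proof -
  have ab: "999 / 1000 < a" "a < 1001 / 1000" "499 / 1000 < b" "b < 501 / 1000"
    using near unfolding abs_less_iff by linarith+
  have im: "\<exists>q\<in>C. r = lozi a b q" if "r \<in> C" for r
    using C(2) that by blast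
  have mem: "lozi a b q \<in> C" if "q \<in> C" for q
    using C(2) that by blast
  have ub: "fst q \<le> 202 / 100" if q: "q \<in> C" for q
  proof -
    \<comment> \<open>At a point \<open>s\<close> of \<open>C\<close> with maximal first coordinate,
      going back two steps gives \<open>fst s \<le> 1 + b * fst s\<close>, hence the bound
      \<open>1 / (1 - b)\<close>, which is close to 2.\<close>
    obtain s where s: "s \<in> C" "\<And>t. t \<in> C \<Longrightarrow> fst t \<le> fst s"
      using continuous_attains_sup[of C fst] C(1) q continuous_on_fst[OF continuous_on_id] by blast
    obtain t u where t: "t \<in> C" "s = lozi a b t" and u: "u \<in> C" "t = lozi a b u"
      using im s(1) by metis
    have "fst s = 1 - a * \<bar>fst t\<bar> + b * fst u"
      using t u by (simp add: lozi_def case_prod_beta)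
    also have "\<dots> \<le> 1 + b * fst s"
    proof -
      have "0 \<le> a * \<bar>fst t\<bar>" using ab by (intro mult_nonneg_nonneg) auto
      moreover have "b * fst u \<le> b * fst s" using s(2)[OF u(1)] ab by (intro mult_left_mono) auto
      ultimately show ?thesis by linarith
    qed
    finally have "(1 - b) * fst s \<le> 1" by (simp add: algebra_simps)
    moreover have "(1 - b) * (202 / 100) > 1" using ab by simp
    ultimately have "(1 - b) * fst s < (1 - b) * (202 / 100)" by linarith
    then have "fst s < 202 / 100" by (rule mult_left_less_imp_less) (use ab in simp)
    then show ?thesis using s(2)[OF q] by linarith
  qed
  show "fst p \<le> 202 / 100" using ub[OF p] .
  \<comment> \<open>At the parameter (1, 1/2), \<open>u\<close> approximates the left eigenvector \<open>(1, (\<surd>3 - 1) / 2)\<close> of the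
    branch \<open>x < 0\<close> for its expanding eigenvalue \<open>(1 + \<surd>3) / 2\<close>: an orbit on which \<open>u\<close> is too
    negative would escape to infinity.\<close>
  define u where "u q = fst q + snd q / 3" for q :: "real \<times> real"
  have cont: "continuous_on C u" unfolding u_def by (intro continuous_intros) simp
  obtain s where s: "s \<in> C" "\<And>t. t \<in> C \<Longrightarrow> u s \<le> u t"
    using continuous_attains_inf[of C u] C(1) p cont by blast
  have snd: "snd q \<le> 202 / 100" if "q \<in> C" for q
    using im[OF that] ub by (auto simp: lozi_def case_prod_beta)
  have "u s \<le> u (lozi a b s)" using s mem by blast
  also have "\<dots> = 1 - a * \<bar>fst s\<bar> + fst s / 3 + b * snd s"
    by (simp add: u_def lozi_def case_prod_beta)
  \<comment> \<open>Since \<open>u s\<close> is minimal and \<open>a + 1 / 3\<close> exceeds 1, this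
    inequality bounds \<open>u s\<close> from below. The coefficient of \<open>snd s\<close> is 1/18
    at (1, 1/2); nearby it stays positive, so that the upper bound on \<open>snd s\<close> applies,
    and below \<open>57 / 1000\<close>.\<close>
  also have "\<dots> \<le> 1 + (a + 1 / 3) * u s + (b - a / 3 - 1 / 9) * snd s"
  proof -
    have "0 \<le> a" using ab by simp
    then have "a * (- fst s) \<le> a * \<bar>fst s\<bar>" by (intro mult_left_mono) auto
    then show ?thesis by (simp add: u_def algebra_simps)
  qed
  also have "(b - a / 3 - 1 / 9) * snd s \<le> (57 / 1000) * (202 / 100)"
  proof -
    have "(b - a / 3 - 1 / 9) * snd s \<le> (b - a / 3 - 1 / 9) * (202 / 100)"
      using snd[OF s(1)] ab by (intro mult_left_mono) simp_all
    also have "\<dots> \<le> (57 / 1000) * (202 / 100)"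
      using ab by simp
    finally show ?thesis .
  qed
  finally have "(a - 2 / 3) * (- u s) \<le> 1 + (57 / 1000) * (202 / 100)"
    by (simp add: algebra_simps)
  moreover have "(a - 2 / 3) * (34 / 10) > 1 + (57 / 1000) * (202 / 100)"
    using ab by simp
  ultimately have "(a - 2 / 3) * (- u s) < (a - 2 / 3) * (34 / 10)" by linarith
  then have "- u s < 34 / 10" by (rule mult_left_less_imp_less) (use ab in simp)
  then show "- (41 / 10) \<le> fst p" using s(2)[OF p] snd[OF p] by (simp add: u_def)
qed

text \<open>The error \<open>1 / 50\<close> leaves room for parameters near (1, 1/2). Indices start at 4 because the
  last two signs are only forced by the existence of four bounded predecessors.\<close>

lemma pseudo_orbit_alternates:
  fixes x :: "nat \<Rightarrow> real"
  assumes ub: "\<And>n. x n \<le> 202 / 100"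
    and err: "\<And>n. \<bar>x (Suc (Suc n)) - (1 - \<bar>x (Suc n)\<bar> + x n / 2)\<bar> \<le> 1 / 50"
    and pm: "0 \<le> x 4" "x 5 < 0"
  shows "0 \<le> x 6 \<and> x 7 < 0"
proof -
  have le: "x (Suc (Suc n)) \<le> 1 - \<bar>x (Suc n)\<bar> + x n / 2 + 1 / 50"
    and ge: "1 - \<bar>x (Suc n)\<bar> + x n / 2 - 1 / 50 \<le> x (Suc (Suc n))" for n
    using err[of n] by linarith+
  have x4: "x 4 \<le> 1 - \<bar>x 3\<bar> + x 2 / 2 + 1 / 50"
    and x5: "1 - x 4 + x 3 / 2 - 1 / 50 \<le> x 5"
    using le[of 2] ge[of 3] pm by (simp_all add: eval_nat_numeral)
  have x6: "1 + x 5 + x 4 / 2 - 1 / 50 \<le> x 6"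
    using ge[of 4] pm by (simp add: eval_nat_numeral)
  have "0 \<le> x 6"
  \<comment> \<open>The bounds on \<open>x 5\<close> and \<open>x 6\<close> combine to
    \<open>x 6 \<ge> 1.96 - (x 4 - x 3) / 2\<close>. The difference \<open>x 4 - x 3\<close> is at
    most 2.02 if \<open>x 3 \<ge> 0\<close>, and at most \<open>1.02 + x 2 / 2 \<le> 2.03\<close>
    otherwise, by the recursion for \<open>x 4\<close>.\<close>
  proof (cases "0 \<le> x 3")
    case True
    then show ?thesis using x5 x6 ub[of 4] by linarith
  next
    case False
    then show ?thesis using x4 x5 x6 ub[of 2] ub[of 4] by linarith
  qed
  moreover have "x 7 < 0"
  \<comment> \<open>The argument runs backwards in time: \<open>x 7 \<ge> 0\<close> forces
    \<open>x 3\<close> to be very negative, then \<open>x 2\<close> to be large and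
    \<open>x 1 < - 1\<close>; but then \<open>x 2\<close> is at most 1.03, as \<open>x 0\<close> is
    bounded above.\<close>
  proof (rule ccontr)
    assume "\<not> x 7 < 0"
    moreover have "x 7 \<le> 1 - x 6 + x 5 / 2 + 1 / 50"
      using le[of 5] \<open>0 \<le> x 6\<close> by (simp add: eval_nat_numeral)
    ultimately have x3: "x 3 \<le> - (17 / 10)" using x5 x6 by linarith
    then have x2: "x 2 \<ge> 13 / 10" using x4 pm(1) by linarith
    have "1 - \<bar>x 2\<bar> + x 1 / 2 - 1 / 50 \<le> x 3"
      using ge[of 1] by (simp add: eval_nat_numeral)
    then have "x 1 < - 1" using x2 x3 ub[of 2] by linarith
    moreover have "x 2 \<le> 1 - \<bar>x 1\<bar> + x 0 / 2 + 1 / 50"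
      using le[of 0] by (simp add: eval_nat_numeral)
    ultimately show False using x2 ub[of 0] by linarith
  qed
  ultimately show ?thesis ..
qed

text \<open>Since the map sends \<open>C\<close> onto itself, \<open>p\<close> has a fourth-order
  preimage in \<open>C\<close>, which supplies the past that the sign argument needs. On the bounded
  strip, replacing \<open>(a, b)\<close> by (1, 1/2) costs an error of at most 1/100 per
  step.\<close>

lemma lozi_alternates:
  assumes near: "\<bar>a - 1\<bar> < 1 / 1000" "\<bar>b - 1 / 2\<bar> < 1 / 1000"
    and C: "compact C" "lozi a b ` C = C"
    and p: "p \<in> C" "0 \<le> fst p" "fst (lozi a b p) < 0"
  shows "0 \<le> fst ((lozi a b ^^ 2) p) \<and> fst ((lozi a b ^^ 3) p) < 0"
proof -
  let ?f = "lozi a b"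
  have im: "(?f ^^ k) ` C = C" for k
    by (induction k) (simp_all only: funpow.simps image_comp[symmetric] C(2) image_ident id_def)
  obtain q where q: "q \<in> C" "p = (?f ^^ 4) q" using im[of 4] p(1) by blast
  define x where "x k = fst ((?f ^^ k) q)" for k
  have bounds: "x k \<le> 202 / 100" "- (41 / 10) \<le> x k" for k
    using lozi_bounds[OF near C, of "(?f ^^ k) q"] im[of k] q(1) unfolding x_def by blast+
  have "\<bar>x (Suc (Suc k)) - (1 - \<bar>x (Suc k)\<bar> + x k / 2)\<bar> \<le> 1 / 50" for k
  proof -
    have "x (Suc (Suc k)) - (1 - \<bar>x (Suc k)\<bar> + x k / 2) = (1 - a) * \<bar>x (Suc k)\<bar> + (b - 1 / 2) * x k"
      by (simp add: x_def lozi_def case_prod_beta algebra_simps)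
    also have "\<bar>\<dots>\<bar> \<le> \<bar>a - 1\<bar> * \<bar>x (Suc k)\<bar> + \<bar>b - 1 / 2\<bar> * \<bar>x k\<bar>"
      using abs_triangle_ineq[of "(1 - a) * \<bar>x (Suc k)\<bar>" "(b - 1 / 2) * x k"]
      by (simp add: abs_mult abs_minus_commute)
    also have "\<dots> \<le> 1 / 1000 * 5 + 1 / 1000 * 5"
      using near bounds[of k] bounds[of "Suc k"] by (intro add_mono mult_mono) (auto simp: abs_le_iff)
    finally show ?thesis by simp
  qed
  moreover have x: "x (k + 4) = fst ((?f ^^ k) p)" for k
    by (simp only: x_def q(2) funpow_add o_apply)
  ultimately show ?thesis
    using pseudo_orbit_alternates[of x] bounds(1) x[of 0] x[of 1] x[of 2] x[of 3] p(2,3)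
    by simp
qed

theorem theorem1p4:
  "\<exists>W :: (real \<times> real) set. open W \<and> (1, 1/2) \<in> W \<and>
     (\<forall>(a, b)\<in>W. topological_entropy (lozi a b) = 0)"
proof -
  define W :: "(real \<times> real) set" where "W = ball 1 (1 / 1000) \<times> ball (1 / 2) (1 / 1000)"
  have "topological_entropy (lozi a b) = 0" if "(a, b) \<in> W" for a b
  proof (rule antisym)
    have near: "\<bar>a - 1\<bar> < 1 / 1000" "\<bar>b - 1 / 2\<bar> < 1 / 1000"
      using that by (auto simp: W_def dist_real_def abs_minus_commute)
    show "topological_entropy (lozi a b) \<le> 0"
      unfolding topological_entropy_def
      by (rule SUP_least, rule topological_entropy_on_lozi_le_0)
        (use lozi_alternates[OF near] in auto)
    show "0 \<le> topological_entropy (lozi a b)"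
      unfolding topological_entropy_def
      by (rule SUP_upper2[where i = "{}"]) (simp_all add: topological_entropy_on_empty)
  qed
  then show ?thesis
    by (intro exI[of _ W]) (auto simp: W_def open_Times)
qed

end
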